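(* Let $G$ be a graph and $\Phi$ a forest of $G$, and let $e_1<e_2<\cdots<e_h$ be an orientation and ordering of the edges not in $\Phi$, with $e_1=\overrightarrow{vu}$. Let $\beta$ be the edge ordering map with data $e_1<e_2<\cdots<e_h$ and $\beta'$ the edge ordering map with data $\overline{e}_1<e_2<\cdots<e_h$, where $\overline{e}_1$ denotes $e_1$ with reversed orientation. Then the two bijections give isomorphic $\operatorname{Pic}^0(G)$-torsors with translating element $[\partial(e_1)]=[(u)-(v)]\in\operatorname{Pic}^0(G)$; that is, for every spanning tree $T$ of $G$, $\beta(T)-\beta'(T)$ is linearly equivalent to $(u)-(v)$.
   Context: Graphs are finite and connected, possibly with parallel edges but without loops; cycles are simple. A divisor is a function $V(G)\to\mathbb{Z}$, written as a formal sum of vertices. The Laplacian $\Delta=D-A$ ($D$ the diagonal degree matrix, $A$ the adjacency matrix counting parallel edges); principal divisors are $\Delta\mathbf{u}$ for $\mathbf{u}\in\mathbb{Z}^{V}$; two divisors are linearly equivalent if their difference is principal; $\operatorname{Pic}^0(G)$ is the group of degree-0 divisors modulo principal divisors. For a directed edge $\overrightarrow{vu}$, $\partial(\overrightarrow{vu})=(u)-(v)$. Edge ordering map with data $e_1<\cdots<e_h$ (oriented, ordered edges outside a forest): orient every cycle so that it traverses its smallest $e_i$ in the given direction; send a spanning tree $T$ to the divisor obtained by orienting each $f\notin T$ as it is traversed by the so-oriented unique cycle in $T+f$ and placing a chip at the head of $f$. Edge ordering maps are bijections from spanning trees to break divisors, and a bijection $\beta$ to divisor classes makes the set of spanning trees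 a $\operatorname{Pic}^0(G)$-torsor; two such bijections $\beta,\beta'$ give isomorphic torsors with translating element $[D_0]$ if $[\beta(T)]=[D_0]+[\beta'(T)]$ for all $T$. *)

theory Defs
  imports
    "Graph_Theory.Bidirected_Digraph"
    "Graph_Theory.Arc_Walk"
    "Graph_Theory.Digraph_Component"
    "HOL-Algebra.Coset"
begin

section \<open>Multigraphs\<close>

text \<open>
  An undirected multigraph is a bidirected digraph: every undirected edge is a pair of opposite
  arcs \<open>{a, arev a}\<close>, so that an arc is the same thing as an oriented edge and parallel edges
  are distinct pairs of arcs. A set of undirected edges is a set of arcs closed under \<open>arev\<close>.
\<close>

locale conn_multigraph = bidirected_digraph G arev + fin_digraph G + loopfree_digraph G
  for G :: "('a, 'b) pre_digraph" and arev :: "'b \<Rightarrow> 'b" +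
  assumes conn: "Digraph_Component.connected G"

definition edge_set :: "('a, 'b) pre_digraph \<Rightarrow> ('b \<Rightarrow> 'b) \<Rightarrow> 'b set \<Rightarrow> bool" where
  "edge_set G arev S \<longleftrightarrow> S \<subseteq> arcs G \<and> arev ` S \<subseteq> S"

text \<open>
  A simple cycle of the undirected graph together with a direction of traversal (and a starting
  point). The walk \<open>[a, arev a]\<close>, which is a cycle of the digraph, is excluded, whereas a
  pair of parallel edges does form a cycle of length two. For the same reason the
  predicates \<open>forest\<close>, \<open>tree\<close> and \<open>spanning_tree\<close> of the digraph library do not apply here.
\<close>

definition oriented_cycle :: "('a, 'b) pre_digraph \<Rightarrow> ('b \<Rightarrow> 'b) \<Rightarrow> 'b awalk \<Rightarrow> bool" where
  "oriented_cycle G arev p \<longleftrightarrow> pre_digraph.cycle G p \<and> (\<forall>a \<in> set p. arev a \<notin> set p)"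

definition forest_in :: "('a, 'b) pre_digraph \<Rightarrow> ('b \<Rightarrow> 'b) \<Rightarrow> 'b set \<Rightarrow> bool" where
  "forest_in G arev F \<longleftrightarrow>
     edge_set G arev F \<and> \<not> (\<exists>p. oriented_cycle G arev p \<and> set p \<subseteq> F)"

definition spanning_tree_in :: "('a, 'b) pre_digraph \<Rightarrow> ('b \<Rightarrow> 'b) \<Rightarrow> 'b set \<Rightarrow> bool" where
  "spanning_tree_in G arev T \<longleftrightarrow>
     forest_in G arev T \<and> Digraph_Component.connected (G\<lparr>arcs := T\<rparr>)"


section \<open>Divisors and the Picard group\<close>

definition adjacency :: "('a, 'b) pre_digraph \<Rightarrow> 'a \<Rightarrow> 'a \<Rightarrow> int" where
  "adjacency G x y = int (card {a \<in> arcs G. tail G a = x \<and> head G a = y})"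

text \<open>The degree of a vertex is its out-degree, since each edge at it has one arc leaving it.\<close>

definition laplacian :: "('a, 'b) pre_digraph \<Rightarrow> ('a \<Rightarrow> int) \<Rightarrow> 'a \<Rightarrow> int" where
  "laplacian G f x = int (out_degree G x) * f x - (\<Sum>y \<in> verts G. adjacency G x y * f y)"

text \<open>Divisors are integer functions on the vertices, extended by zero to the whole type.\<close>

definition Div :: "('a, 'b) pre_digraph \<Rightarrow> ('a \<Rightarrow> int) monoid" where
  "Div G = \<lparr>carrier = {D. \<forall>x. x \<notin> verts G \<longrightarrow> D x = 0},
            mult = (\<lambda>D E x. D x + E x), one = (\<lambda>x. 0)\<rparr>"

definition divisor_degree :: "('a, 'b) pre_digraph \<Rightarrow> ('a \<Rightarrow> int) \<Rightarrow> int" where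
  "divisor_degree G D = (\<Sum>x \<in> verts G. D x)"

definition Div0 :: "('a, 'b) pre_digraph \<Rightarrow> ('a \<Rightarrow> int) monoid" where
  "Div0 G = (Div G)\<lparr>carrier := {D \<in> carrier (Div G). divisor_degree G D = 0}\<rparr>"

definition principal_divisors :: "('a, 'b) pre_digraph \<Rightarrow> ('a \<Rightarrow> int) set" where
  "principal_divisors G = range (laplacian G)"

definition linearly_equivalent ::
  "('a, 'b) pre_digraph \<Rightarrow> ('a \<Rightarrow> int) \<Rightarrow> ('a \<Rightarrow> int) \<Rightarrow> bool" where
  "linearly_equivalent G D E \<longleftrightarrow> (\<lambda>x. D x - E x) \<in> principal_divisors G"

definition Pic :: "('a, 'b) pre_digraph \<Rightarrow> ('a \<Rightarrow> int) set monoid" where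
  "Pic G = Div G Mod principal_divisors G"

definition Pic0 :: "('a, 'b) pre_digraph \<Rightarrow> ('a \<Rightarrow> int) set monoid" where
  "Pic0 G = Div0 G Mod principal_divisors G"

definition divisor_class :: "('a, 'b) pre_digraph \<Rightarrow> ('a \<Rightarrow> int) \<Rightarrow> ('a \<Rightarrow> int) set" where
  "divisor_class G D = principal_divisors G #>\<^bsub>Div G\<^esub> D"

definition chip :: "'a \<Rightarrow> 'a \<Rightarrow> int" where
  "chip x y = (if y = x then 1 else 0)"

definition boundary :: "('a, 'b) pre_digraph \<Rightarrow> 'b \<Rightarrow> 'a \<Rightarrow> int" where
  "boundary G a y = chip (head G a) y - chip (tail G a) y"


section \<open>Edge ordering maps\<close>

text \<open>
  The data \<open>e\<^sub>1 < \<dots> < e\<^sub>h\<close> is a list of arcs that contains exactly one of the two orientations of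
  every edge outside \<open>F\<close>, and nothing else.
\<close>

definition ordering_data ::
  "('a, 'b) pre_digraph \<Rightarrow> ('b \<Rightarrow> 'b) \<Rightarrow> 'b set \<Rightarrow> 'b list \<Rightarrow> bool" where
  "ordering_data G arev F es \<longleftrightarrow>
     distinct es \<and> set es \<subseteq> arcs G - F \<and>
     (\<forall>a \<in> arcs G - F. (a \<in> set es) \<noteq> (arev a \<in> set es))"

text \<open>The traversal \<open>p\<close> uses its smallest edge from the list in the given direction.\<close>

definition compatible_cycle :: "('b \<Rightarrow> 'b) \<Rightarrow> 'b list \<Rightarrow> 'b awalk \<Rightarrow> bool" where
  "compatible_cycle arev es p \<longleftrightarrow>
     (\<exists>i < length es. es ! i \<in> set p \<and>
        (\<forall>j < i. es ! j \<notin> set p \<and> arev (es ! j) \<notin> set p))"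

text \<open>
  The edges outside the spanning tree \<open>T\<close>, each with its orientation in the compatibly oriented
  fundamental cycle. The cycle runs through \<open>a\<close> itself, hence not through \<open>arev a\<close>, so
  it lies in \<open>T + f\<close>, where \<open>f\<close> is the undirected edge of \<open>a\<close>, precisely when its arcs lie
  in \<open>insert a T\<close>.
\<close>

definition oriented_chords ::
  "('a, 'b) pre_digraph \<Rightarrow> ('b \<Rightarrow> 'b) \<Rightarrow> 'b list \<Rightarrow> 'b set \<Rightarrow> 'b set" where
  "oriented_chords G arev es T =
     {a \<in> arcs G - T. \<exists>p. oriented_cycle G arev p \<and> compatible_cycle arev es p \<and>
                         a \<in> set p \<and> set p \<subseteq> insert a T}"

definition edge_ordering_map ::
  "('a, 'b) pre_digraph \<Rightarrow> ('b \<Rightarrow> 'b) \<Rightarrow> 'b list \<Rightarrow> 'b set \<Rightarrow> 'a \<Rightarrow> int" where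
  "edge_ordering_map G arev es T = (\<lambda>x. \<Sum>a \<in> oriented_chords G arev es T. chip (head G a) x)"

text \<open>
  Two maps from spanning trees to divisors give isomorphic torsors with translating element
  \<open>c\<close>. Edge ordering maps are known to induce bijections onto the divisor classes of a fixed
  degree; this is not part of the condition.
\<close>

definition isomorphic_torsors_with_translating_element ::
  "('a, 'b) pre_digraph \<Rightarrow> ('b \<Rightarrow> 'b) \<Rightarrow> ('b set \<Rightarrow> 'a \<Rightarrow> int) \<Rightarrow> ('b set \<Rightarrow> 'a \<Rightarrow> int)
     \<Rightarrow> ('a \<Rightarrow> int) set \<Rightarrow> bool" where
  "isomorphic_torsors_with_translating_element G arev \<beta> \<beta>' c \<longleftrightarrow>
     c \<in> carrier (Pic0 G) \<and>
     (\<forall>T. spanning_tree_in G arev T \<longrightarrow>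
        divisor_class G (\<beta> T) = c \<otimes>\<^bsub>Pic G\<^esub> divisor_class G (\<beta>' T))"

end

theory Submission
  imports Defs
begin

text \<open>
  Reversing \<open>e\<^sub>1\<close> reorients exactly the chords of \<open>T\<close> whose fundamental cycle uses the edge of
  \<open>e\<^sub>1\<close>. If \<open>e\<^sub>1\<close> is not in \<open>T\<close>, the only such chord is \<open>e\<^sub>1\<close> itself, and the two divisors differ
  by exactly \<open>(u) - (v)\<close>. If \<open>e\<^sub>1\<close> is in \<open>T\<close>, these chords are the other edges of the cut between
  the component \<open>A\<close> of \<open>v\<close> in \<open>T - e\<^sub>1\<close> and its complement; for \<open>\<beta>\<close> they point into \<open>A\<close>, for
  \<open>\<beta>'\<close> out of it. Hence \<open>\<beta>(T) - \<beta>'(T) - ((u) - (v))\<close> is the Laplacian of the indicator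
  function of \<open>A\<close>.
\<close>

section \<open>Fundamental cycles and cuts\<close>

context conn_multigraph
begin

section \<open>Walks and fundamental cycles inside a set of arcs\<close>

definition joined :: "'b set \<Rightarrow> 'a \<Rightarrow> 'a \<Rightarrow> bool" where
  "joined S x y \<longleftrightarrow> (\<exists>p. awalk x p y \<and> set p \<subseteq> S)"

lemma joined_step:
  assumes "joined S x (tail G c)" and "c \<in> S" and "c \<in> arcs G"
  shows "joined S x (head G c)"
proof -
  obtain p where "awalk x p (tail G c)" "set p \<subseteq> S"
    using assms(1) unfolding joined_def by blast
  then have "awalk x (p @ [c]) (head G c)" "set (p @ [c]) \<subseteq> S"
    using arc_implies_awalk[OF assms(3)] assms(2) by auto
  then show ?thesis unfolding joined_def by blast
qed

lemma joined_if_reachable: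
  assumes "S \<subseteq> arcs G" and "x \<rightarrow>\<^sup>*\<^bsub>G\<lparr>arcs := S\<rparr>\<^esub> y"
  shows "joined S x y"
proof -
  interpret H: wf_digraph "G\<lparr>arcs := S\<rparr>" using assms(1) by unfold_locales auto
  show ?thesis
    using assms(2)
  proof (induction rule: H.reachable_induct)
    case base
    then show ?case by (auto simp: joined_def awalk_Nil_iff intro: exI[of _ "[]"])
  next
    case (step y z)
    then obtain c where "c \<in> S" "tail G c = y" "head G c = z"
      by (auto simp: arcs_ends_conv)
    then show ?case using step.IH joined_step assms(1) by blast
  qed
qed

lemma edge_set_arev_iff:
  assumes "edge_set G arev S"
  shows "arev a \<in> S \<longleftrightarrow> a \<in> S"
  using assms unfolding edge_set_def by (metis arev_arev image_subset_iff)

text \<open>Connectedness of a digraph disregards directions. Since \<open>T\<close> is closed under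
  \<open>arev\<close>, the subgraph is symmetric, hence strongly connected, which provides a
  directed walk.\<close>

lemma joined_if_spanning_tree:
  assumes "spanning_tree_in G arev T" and "x \<in> verts G" and "y \<in> verts G"
  shows "joined T x y"
proof -
  let ?H = "G\<lparr>arcs := T\<rparr>"
  have T: "edge_set G arev T" and con: "Digraph_Component.connected ?H"
    using assms(1) by (auto simp: spanning_tree_in_def forest_in_def)
  then have sub: "T \<subseteq> arcs G" by (simp add: edge_set_def)
  interpret H: wf_digraph ?H using sub by unfold_locales auto
  have "symmetric ?H"
    unfolding symmetric_conv using sub edge_set_arev_iff[OF T]
    by (auto intro!: bexI[of _ "arev _"])
  then have "strongly_connected ?H"
    using H.symmetric_connected_imp_strongly_connected con by blast
  then show ?thesis
    using joined_if_reachable[OF sub] assms(2,3) by (auto simp: strongly_connected_def)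
qed

text \<open>An arc followed later by its reverse would bring the path back to the tail of that arc,
  a vertex already visited.\<close>

lemma apath_arev_notin:
  assumes "apath x p y" and "b \<in> set p"
  shows "arev b \<notin> set p"
  using assms
proof (induction p arbitrary: x)
  case (Cons e es)
  from Cons.prems have e: "e \<in> arcs G" and es: "apath (head G e) es y"
    and nin: "tail G e \<notin> set (awalk_verts (head G e) es)"
    by (auto simp: apath_Cons_iff)
  have aw: "awalk (head G e) es y" using es by (rule awalkI_apath)
  have "arev e \<notin> set es"
    using nin e awalk_verts_arc2[OF aw, of "arev e"] by auto
  then show ?case
    using Cons.IH[OF es] Cons.prems(2) arev_neq[OF e] by (metis arev_arev set_ConsD)
qed simp

text \<open>The walk in \<open>S\<close> shortens to a path, and \<open>a\<close> closes it up. A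
  path never contains an arc together with its reverse, and \<open>a\<close> and
  \<open>arev a\<close> lie outside \<open>S\<close>, so the degenerate cycle is excluded.\<close>

lemma oriented_cycle_through:
  assumes "joined S (head G a) (tail G a)"
    and "a \<in> arcs G" and "a \<notin> S" and "arev a \<notin> S"
  shows "\<exists>p. oriented_cycle G arev p \<and> a \<in> set p \<and> set p \<subseteq> insert a S"
proof -
  obtain q where q: "apath (head G a) q (tail G a)" "set q \<subseteq> S"
    using assms(1) apath_awalk_to_apath awalk_to_apath_subset
    unfolding joined_def by (meson subset_trans)
  have "cycle (a # q)"
    unfolding cycle_def using q(1) assms(2) by (auto simp: apath_def awalk_Cons_iff)
  moreover have "\<forall>b \<in> set (a # q). arev b \<notin> set (a # q)"
    using apath_arev_notin[OF q(1)] q(2) assms(2-4) arev_neq by auto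
  ultimately have "oriented_cycle G arev (a # q)" by (simp add: oriented_cycle_def)
  then show ?thesis using q(2) by (intro exI[of _ "a # q"]) auto
qed

lemma fundamental_cycle_exists:
  assumes "spanning_tree_in G arev T" and "a \<in> arcs G - T"
  shows "\<exists>p. oriented_cycle G arev p \<and> a \<in> set p \<and> set p \<subseteq> insert a T"
proof -
  have "edge_set G arev T"
    using assms(1) by (simp add: spanning_tree_in_def forest_in_def)
  then show ?thesis
    using assms oriented_cycle_through joined_if_spanning_tree edge_set_arev_iff by auto
qed

section \<open>The fundamental cut of a tree edge\<close>

text \<open>For a tree edge this is the shore of its fundamental cut that contains the tail of
  \<open>b\<close>. Both orientations are deleted, as an edge is a pair of arcs.\<close>

definition cut_side :: "'b set \<Rightarrow> 'b \<Rightarrow> 'a set" where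
  "cut_side T b = {x. joined (T - {b, arev b}) (tail G b) x}"

lemma tail_in_cut_side: "b \<in> arcs G \<Longrightarrow> tail G b \<in> cut_side T b"
  by (auto simp: cut_side_def joined_def awalk_Nil_iff intro: exI[of _ "[]"])

text \<open>Otherwise a walk from the tail to the head of \<open>b\<close> off this edge would close
  up with \<open>arev b\<close> to a cycle in the forest.\<close>

lemma head_notin_cut_side:
  assumes "forest_in G arev T" and "b \<in> T"
  shows "head G b \<notin> cut_side T b"
proof
  have T: "edge_set G arev T" using assms(1) by (simp add: forest_in_def)
  then have b: "b \<in> arcs G" using assms(2) by (auto simp: edge_set_def)
  assume "head G b \<in> cut_side T b"
  then have "joined (T - {b, arev b}) (head G (arev b)) (tail G (arev b))"
    using b by (simp add: cut_side_def)
  then obtain p where "oriented_cycle G arev p" "set p \<subseteq> insert (arev b) (T - {b, arev b})"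
    using oriented_cycle_through[of "T - {b, arev b}" "arev b"] b by auto
  moreover have "arev b \<in> T" using edge_set_arev_iff[OF T] assms(2) by simp
  ultimately show False using assms(1) unfolding forest_in_def by blast
qed

text \<open>A walk from the tail of \<open>b\<close> can be prolonged by \<open>c\<close> and
  equally by \<open>arev c\<close>, so only the edge of \<open>b\<close> can leave the
  component.\<close>

lemma cut_side_cong:
  assumes "edge_set G arev T" and "c \<in> T - {b, arev b}"
  shows "head G c \<in> cut_side T b \<longleftrightarrow> tail G c \<in> cut_side T b"
proof -
  have c: "c \<in> arcs G" using assms by (auto simp: edge_set_def)
  have "arev c \<in> T - {b, arev b}"
    using assms edge_set_arev_iff by (metis DiffE DiffI arev_arev insert_iff singletonD)
  then show ?thesis
    using joined_step[of _ _ c] joined_step[of _ _ "arev c"] assms(2) c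
    by (auto simp: cut_side_def)
qed

lemma awalk_sum_telescope:
  fixes f :: "'a \<Rightarrow> int"
  assumes "awalk x p y"
  shows "(\<Sum>c\<leftarrow>p. f (head G c) - f (tail G c)) = f y - f x"
  using assms
proof (induction p arbitrary: x)
  case (Cons c p)
  then have "tail G c = x" "awalk (head G c) p y" by (auto simp: awalk_Cons_iff)
  then show ?case using Cons.IH by simp
qed (simp add: awalk_Nil_iff)

text \<open>A potential has no net change around a closed walk. The arcs of a cycle are distinct, so
  the telescoping list sum is a sum over the set.\<close>

lemma cycle_sum_zero:
  fixes f :: "'a \<Rightarrow> int"
  assumes "cycle p"
  shows "(\<Sum>c\<in>set p. f (head G c) - f (tail G c)) = 0"
proof -
  obtain x where "awalk x p x" "distinct p" using assms by (auto simp: cycle_conv)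
  then show ?thesis
    using awalk_sum_telescope[of x p x f] by (simp add: sum_list_distinct_conv_sum_set)
qed

text \<open>A cycle crosses the cut of \<open>b\<close> equally often in both directions, and apart from
  \<open>b\<close> and \<open>arev b\<close> only \<open>a\<close> can cross it.\<close>

lemma mem_fundamental_cycle_iff:
  assumes "forest_in G arev T" and "b \<in> T" and "a \<in> arcs G - T"
    and "oriented_cycle G arev p" and "a \<in> set p" and "set p \<subseteq> insert a T"
  shows "b \<in> set p \<longleftrightarrow> head G a \<in> cut_side T b \<and> tail G a \<notin> cut_side T b"
    and "arev b \<in> set p \<longleftrightarrow> tail G a \<in> cut_side T b \<and> head G a \<notin> cut_side T b"
proof -
  \<comment> \<open>With the indicator of the cut side as potential, \<open>?g\<close> is the signed
    crossing number: 1 for entering the side, -1 for leaving it, 0 otherwise.\<close>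
  let ?f = "\<lambda>x. if x \<in> cut_side T b then 1 else 0 :: int"
  let ?g = "\<lambda>c. ?f (head G c) - ?f (tail G c)"
  have T: "edge_set G arev T" using assms(1) by (simp add: forest_in_def)
  have b: "b \<in> arcs G" using T assms(2) by (auto simp: edge_set_def)
  have "arev b \<in> T" using edge_set_arev_iff[OF T] assms(2) by simp
  then have ne: "a \<noteq> b" "a \<noteq> arev b" "arev b \<noteq> b"
    using assms(2,3) arev_neq[OF b] by auto
  have fb: "?f (tail G b) = 1" "?f (head G b) = 0"
    using tail_in_cut_side[OF b] head_notin_cut_side[OF assms(1,2)] by auto
  have "(\<Sum>c\<in>set p. ?g c) = (\<Sum>c\<in>set p \<inter> {a, b, arev b}. ?g c)"
    by (rule sum.mono_neutral_right) (use cut_side_cong[OF T] assms(6) in auto)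
  moreover have "(\<Sum>c\<in>set p. ?g c) = 0"
    using cycle_sum_zero[of p ?f] assms(4) by (simp only: oriented_cycle_def)
  ultimately have sum: "(\<Sum>c\<in>set p \<inter> {a, b, arev b}. ?g c) = 0" by simp
  have "\<not> (b \<in> set p \<and> arev b \<in> set p)" using assms(4) by (auto simp: oriented_cycle_def)
  then consider "b \<in> set p" "arev b \<notin> set p" | "b \<notin> set p" "arev b \<in> set p"
    | "b \<notin> set p" "arev b \<notin> set p" by blast
  then have "(b \<in> set p \<longleftrightarrow> head G a \<in> cut_side T b \<and> tail G a \<notin> cut_side T b)
    \<and> (arev b \<in> set p \<longleftrightarrow> tail G a \<in> cut_side T b \<and> head G a \<notin> cut_side T b)"
  proof cases
    case 1
    then have "set p \<inter> {a, b, arev b} = {a, b}" using assms(5) by auto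
    \<comment> \<open>Here \<open>b\<close> leaves the side, so \<open>?g b\<close> is -1 and
      \<open>a\<close> has to enter it; in the next case \<open>arev b\<close> enters and
      \<open>a\<close> leaves.\<close>
    then have "?g a + ?g b = 0" using sum ne by simp
    then show ?thesis using 1 fb by (auto split: if_splits)
  next
    case 2
    then have "set p \<inter> {a, b, arev b} = {a, arev b}" using assms(5) by auto
    then have "?g a + ?g (arev b) = 0" using sum ne by simp
    then show ?thesis using 2 fb b by (auto split: if_splits)
  next
    case 3
    then have "set p \<inter> {a, b, arev b} = {a}" using assms(5) by auto
    then have "?g a = 0" using sum by simp
    then show ?thesis using 3 by (auto split: if_splits)
  qed
  then show "b \<in> set p \<longleftrightarrow> head G a \<in> cut_side T b \<and> tail G a \<notin> cut_side T b"
    and "arev b \<in> set p \<longleftrightarrow> tail G a \<in> cut_side T b \<and> head G a \<notin> cut_side T b" by auto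
qed

text \<open>Which tree arcs lie on the cycle is determined by how \<open>a\<close> crosses their
  cuts, and \<open>a\<close> is its only arc outside \<open>T\<close>. Only the arc sets agree; the
  starting points may differ.\<close>

lemma fundamental_cycle_unique:
  assumes "forest_in G arev T" and "a \<in> arcs G - T"
    and "oriented_cycle G arev p" and "a \<in> set p" and "set p \<subseteq> insert a T"
    and "oriented_cycle G arev q" and "a \<in> set q" and "set q \<subseteq> insert a T"
  shows "set p = set q"
proof (rule Set.set_eqI)
  fix b
  show "b \<in> set p \<longleftrightarrow> b \<in> set q"
  proof (cases "b \<in> T")
    case True
    then show ?thesis
      using mem_fundamental_cycle_iff(1)[OF assms(1) True assms(2)] assms(3-8) by simp
  next
    case False
    then show ?thesis using assms(4,5,7,8) by auto
  qed
qed

end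


section \<open>Oriented chords\<close>

text \<open>Index 0 gives the first disjunct; a larger index forces \<open>p\<close> to avoid both
  orientations of \<open>e\<close>. The direction of \<open>e\<close> thus matters only in the first
  disjunct.\<close>

lemma compatible_cycle_Cons:
  "compatible_cycle r (e # es) p \<longleftrightarrow>
     e \<in> set p \<or> e \<notin> set p \<and> r e \<notin> set p \<and> compatible_cycle r es p"
proof -
  have "compatible_cycle r (e # es) p \<longleftrightarrow>
    (\<exists>i. i < Suc (length es) \<and> (e # es) ! i \<in> set p \<and>
      (\<forall>j < i. (e # es) ! j \<notin> set p \<and> r ((e # es) ! j) \<notin> set p))"
    by (simp add: compatible_cycle_def)
  also have "\<dots> \<longleftrightarrow> e \<in> set p \<or>
    (\<exists>i < length es. es ! i \<in> set p \<and> e \<notin> set p \<and> r e \<notin> set p \<and>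
      (\<forall>j < i. es ! j \<notin> set p \<and> r (es ! j) \<notin> set p))"
    by (simp add: Ex_less_Suc2 All_less_Suc2)
  finally show ?thesis unfolding compatible_cycle_def by blast
qed

context conn_multigraph
begin

definition chords_along :: "'b set \<Rightarrow> 'b \<Rightarrow> 'b set" where
  "chords_along T e = {a \<in> arcs G - T. \<exists>p. oriented_cycle G arev p \<and> e \<in> set p \<and>
                         a \<in> set p \<and> set p \<subseteq> insert a T}"

text \<open>The conditions are symmetric in \<open>e\<close> and \<open>arev e\<close>, so reversing
  the first edge leaves this share of the chords unchanged.\<close>

definition chords_avoiding :: "'b list \<Rightarrow> 'b set \<Rightarrow> 'b \<Rightarrow> 'b set" where
  "chords_avoiding es T e = {a \<in> arcs G - T. \<exists>p. oriented_cycle G arev p \<and>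
     e \<notin> set p \<and> arev e \<notin> set p \<and> compatible_cycle arev es p \<and> a \<in> set p \<and> set p \<subseteq> insert a T}"

lemma oriented_chords_Cons:
  "oriented_chords G arev (e # es) T = chords_along T e \<union> chords_avoiding es T e"
  by (auto simp: oriented_chords_def chords_along_def chords_avoiding_def compatible_cycle_Cons)

lemma chords_avoiding_arev: "chords_avoiding es T (arev e) = chords_avoiding es T e"
  by (auto simp: chords_avoiding_def)

text \<open>The arc set of the cycle through a given chord arc is unique, so it cannot both contain
  and miss \<open>e\<close>.\<close>

lemma chords_along_avoiding_disjoint:
  assumes "forest_in G arev T"
  shows "chords_along T e \<inter> chords_avoiding es T e = {}"
proof -
  have False if a: "a \<in> chords_along T e" "a \<in> chords_avoiding es T e" for a
  proof -
    obtain p q where "oriented_cycle G arev p" "a \<in> set p" "set p \<subseteq> insert a T" "e \<in> set p"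
      and "oriented_cycle G arev q" "a \<in> set q" "set q \<subseteq> insert a T" "e \<notin> set q"
      using a unfolding chords_along_def chords_avoiding_def by blast
    moreover have "a \<in> arcs G - T" using a(1) by (simp add: chords_along_def)
    ultimately show False using fundamental_cycle_unique[OF assms, of a p q] by blast
  qed
  then show ?thesis by blast
qed

lemma edge_ordering_map_Cons:
  assumes "forest_in G arev T"
  shows "edge_ordering_map G arev (e # es) T x =
    (\<Sum>a\<in>chords_along T e. chip (head G a) x) + (\<Sum>a\<in>chords_avoiding es T e. chip (head G a) x)"
proof -
  have "finite (chords_along T e)" "finite (chords_avoiding es T e)"
    by (auto simp: chords_along_def chords_avoiding_def intro: finite_subset[OF _ finite_arcs])
  then show ?thesis
    unfolding edge_ordering_map_def oriented_chords_Cons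
    using chords_along_avoiding_disjoint[OF assms] by (simp add: sum.union_disjoint)
qed

text \<open>A fundamental cycle has just one arc outside \<open>T\<close>, so it runs through
  \<open>e\<close> only as the cycle of \<open>e\<close> itself.\<close>

lemma chords_along_chord:
  assumes "spanning_tree_in G arev T" and "e \<in> arcs G - T"
  shows "chords_along T e = {e}"
proof
  show "chords_along T e \<subseteq> {e}" using assms(2) by (auto simp: chords_along_def)
  show "{e} \<subseteq> chords_along T e"
    using fundamental_cycle_exists[OF assms] assms(2) unfolding chords_along_def by blast
qed

text \<open>The arc \<open>e\<close> leaves the cut side, so a cycle using it must return through
  its chord; for \<open>arev e\<close> the directions are exchanged.\<close>

lemma chords_along_tree_edge:
  assumes "spanning_tree_in G arev T" and "e \<in> T"
  shows "chords_along T e =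
      {a \<in> arcs G - T. head G a \<in> cut_side T e \<and> tail G a \<notin> cut_side T e}"
    and "chords_along T (arev e) =
      {a \<in> arcs G - T. tail G a \<in> cut_side T e \<and> head G a \<notin> cut_side T e}"
proof -
  have F: "forest_in G arev T" using assms(1) by (simp add: spanning_tree_in_def)
  show "chords_along T e =
      {a \<in> arcs G - T. head G a \<in> cut_side T e \<and> tail G a \<notin> cut_side T e}"
    using mem_fundamental_cycle_iff(1)[OF F assms(2)] fundamental_cycle_exists[OF assms(1)]
    unfolding chords_along_def by blast
  show "chords_along T (arev e) =
      {a \<in> arcs G - T. tail G a \<in> cut_side T e \<and> head G a \<notin> cut_side T e}"
    using mem_fundamental_cycle_iff(2)[OF F assms(2)] fundamental_cycle_exists[OF assms(1)]
    unfolding chords_along_def by blast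
qed


section \<open>The Laplacian and linear equivalence\<close>

text \<open>This form places chips at heads, as edge ordering maps do, so the two can be compared
  arc by arc.\<close>

lemma laplacian_eq_sum_arcs:
  "laplacian G f x = (\<Sum>a\<in>arcs G. chip (head G a) x * (f (head G a) - f (tail G a)))"
proof -
  let ?O = "{a \<in> arcs G. tail G a = x}"
  \<comment> \<open>Grouping the arcs leaving \<open>x\<close> by their heads turns parallel arcs
    into the multiplicity in \<open>adjacency\<close>.\<close>
  have "(\<Sum>a\<in>?O. f (head G a)) = (\<Sum>y\<in>verts G. \<Sum>a\<in>{a \<in> ?O. head G a = y}. f (head G a))"
    by (rule sum.group[symmetric]) auto
  also have "\<dots> = (\<Sum>y\<in>verts G. adjacency G x y * f y)"
    by (simp add: adjacency_def conj_assoc)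
  finally have adj: "(\<Sum>a\<in>?O. f (head G a)) = (\<Sum>y\<in>verts G. adjacency G x y * f y)" .
  have "laplacian G f x = (\<Sum>a\<in>?O. f x) - (\<Sum>a\<in>?O. f (head G a))"
    unfolding laplacian_def adj by (simp add: out_degree_def out_arcs_def)
  also have "\<dots> = (\<Sum>a\<in>?O. f (tail G a) - f (head G a))"
    unfolding sum_subtractf[symmetric] by (rule sum.cong) auto
  also have "\<dots> = (\<Sum>a\<in>arcs G. chip (tail G a) x * (f (tail G a) - f (head G a)))"
    by (simp add: chip_def sum.inter_filter if_distrib[of "\<lambda>k. k * _"] eq_commute cong: if_cong)
  \<comment> \<open>The involution \<open>arev\<close> exchanges heads and tails, turning outgoing
    into incoming arcs.\<close>
  also have "\<dots> = (\<Sum>a\<in>arcs G. chip (head G a) x * (f (head G a) - f (tail G a)))"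
    by (rule sum.reindex_bij_witness[of _ arev arev]) auto
  finally show ?thesis .
qed

text \<open>Only arcs crossing the cut of \<open>A\<close> contribute: coefficient 1 on entering
  \<open>A\<close>, -1 on leaving it.\<close>

lemma laplacian_indicator:
  "laplacian G (\<lambda>x. if x \<in> A then 1 else 0) x =
     (\<Sum>a | a \<in> arcs G \<and> head G a \<in> A \<and> tail G a \<notin> A. chip (head G a) x)
     - (\<Sum>a | a \<in> arcs G \<and> tail G a \<in> A \<and> head G a \<notin> A. chip (head G a) x)"
  unfolding laplacian_eq_sum_arcs sum.inter_filter[OF finite_arcs] sum_subtractf[symmetric]
  by (rule sum.cong) auto

section \<open>Reversing the first edge of the data\<close>

lemma edge_ordering_map_flip_first:
  assumes T: "spanning_tree_in G arev T" and e: "e \<in> arcs G"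
  shows "\<exists>f. \<forall>x. edge_ordering_map G arev (e # es) T x
      - edge_ordering_map G arev (arev e # es) T x - boundary G e x = laplacian G f x"
proof -
  have F: "forest_in G arev T" using T by (simp add: spanning_tree_in_def)
  then have S: "edge_set G arev T" by (simp add: forest_in_def)
  let ?c = "\<lambda>x a. chip (head G a) x"
  have diff: "edge_ordering_map G arev (e # es) T x - edge_ordering_map G arev (arev e # es) T x
      = (\<Sum>a\<in>chords_along T e. ?c x a) - (\<Sum>a\<in>chords_along T (arev e). ?c x a)" for x
    by (simp add: edge_ordering_map_Cons[OF F] chords_avoiding_arev)
  show ?thesis
  proof (cases "e \<in> T")
    case False
    then have "arev e \<in> arcs G - T" using e edge_set_arev_iff[OF S] by simp
    \<comment> \<open>Each \<open>chords_along\<close> is now a singleton, so the difference is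
      \<open>boundary G e\<close> exactly and the zero function is a witness.\<close>
    then have "edge_ordering_map G arev (e # es) T x
      - edge_ordering_map G arev (arev e # es) T x - boundary G e x = laplacian G (\<lambda>x. 0) x" for x
      unfolding diff using False e chords_along_chord[OF T]
      by (simp add: boundary_def laplacian_def)
    then show ?thesis by blast
  next
    case True
    let ?A = "cut_side T e"
    let ?in = "{a. a \<in> arcs G \<and> head G a \<in> ?A \<and> tail G a \<notin> ?A}"
    let ?out = "{a. a \<in> arcs G \<and> tail G a \<in> ?A \<and> head G a \<notin> ?A}"
    have re: "arev e \<in> T" using edge_set_arev_iff[OF S] True by simp
    have ends: "tail G e \<in> ?A" "head G e \<notin> ?A"
      using tail_in_cut_side[OF e] head_notin_cut_side[OF F True] by auto
    have T_arc: "c = e \<or> c = arev e \<or> (head G c \<in> ?A \<longleftrightarrow> tail G c \<in> ?A)" if "c \<in> T" for c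
      using cut_side_cong[OF S, of c e] that by blast
    have fin: "finite (chords_along T b)" for b
      by (auto simp: chords_along_def intro: finite_subset[OF _ finite_arcs])
    \<comment> \<open>The arcs entering \<open>?A\<close> are the chords along \<open>e\<close> and
      one tree arc, \<open>arev e\<close>; those leaving it are the chords along
      \<open>arev e\<close> and \<open>e\<close>. The two extra chips, at the tail and head of
      \<open>e\<close>, supply the term \<open>- boundary G e x\<close>.\<close>
    have i: "?in = insert (arev e) (chords_along T e)"
    proof (rule Set.set_eqI)
      fix c show "c \<in> ?in \<longleftrightarrow> c \<in> insert (arev e) (chords_along T e)"
        using T_arc[of c] ends e re arev_neq[OF e] unfolding chords_along_tree_edge(1)[OF T True]
        by (cases "c \<in> T") auto
    qed
    have o: "?out = insert e (chords_along T (arev e))"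
    proof (rule Set.set_eqI)
      fix c show "c \<in> ?out \<longleftrightarrow> c \<in> insert e (chords_along T (arev e))"
        using T_arc[of c] ends e True unfolding chords_along_tree_edge(2)[OF T True]
        by (cases "c \<in> T") auto
    qed
    have "arev e \<notin> chords_along T e" "e \<notin> chords_along T (arev e)"
      using re True by (auto simp: chords_along_def)
    then have "edge_ordering_map G arev (e # es) T x
      - edge_ordering_map G arev (arev e # es) T x - boundary G e x
      = laplacian G (\<lambda>x. if x \<in> ?A then 1 else 0) x" for x
      unfolding diff laplacian_indicator i o using fin e by (simp add: boundary_def)
    then show ?thesis by blast
  qed
qed

section \<open>Principal divisors and divisor classes\<close>

lemma Div_comm_group: "comm_group (Div G)"
proof (rule comm_groupI)
  fix D assume "D \<in> carrier (Div G)"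
  then show "\<exists>E\<in>carrier (Div G). E \<otimes>\<^bsub>Div G\<^esub> D = \<one>\<^bsub>Div G\<^esub>"
    by (intro bexI[of _ "\<lambda>x. - D x"]) (auto simp: Div_def)
qed (auto simp: Div_def add.assoc add.commute)

lemma laplacian_in_Div: "laplacian G f \<in> carrier (Div G)"
proof -
  have "laplacian G f x = 0" if "x \<notin> verts G" for x
    unfolding laplacian_eq_sum_arcs
    by (rule sum.neutral) (use that head_in_verts in \<open>auto simp: chip_def\<close>)
  then show ?thesis by (auto simp: Div_def)
qed

text \<open>The Laplacian is additive in the function, so its range is closed under sums and
  inverses.\<close>

lemma principal_subgroup: "subgroup (principal_divisors G) (Div G)"
proof -
  interpret D: comm_group "Div G" by (rule Div_comm_group)
  have inv: "inv\<^bsub>Div G\<^esub> (laplacian G f) = laplacian G (\<lambda>x. - f x)" for f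
  proof (rule D.inv_equality[OF _ laplacian_in_Div laplacian_in_Div])
    show "laplacian G (\<lambda>x. - f x) \<otimes>\<^bsub>Div G\<^esub> laplacian G f = \<one>\<^bsub>Div G\<^esub>"
      by (simp add: Div_def laplacian_def fun_eq_iff sum_negf)
  qed
  have mult: "laplacian G f \<otimes>\<^bsub>Div G\<^esub> laplacian G g = laplacian G (\<lambda>x. f x + g x)" for f g
    by (simp add: Div_def laplacian_def fun_eq_iff sum.distrib algebra_simps)
  show ?thesis
    by (rule D.subgroupI) (auto simp: principal_divisors_def inv mult laplacian_in_Div)
qed

lemma principal_normal: "principal_divisors G \<lhd> Div G"
  using comm_group.subgroup_imp_normal[OF Div_comm_group principal_subgroup] .

text \<open>The divisor \<open>D\<close> lies in the coset of \<open>E\<close>, and a coset is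
  represented by each of its elements.\<close>

lemma divisor_class_eq:
  assumes "E \<in> carrier (Div G)" and "linearly_equivalent G D E"
  shows "divisor_class G D = divisor_class G E"
proof -
  interpret D: comm_group "Div G" by (rule Div_comm_group)
  have "D = (\<lambda>x. D x - E x) \<otimes>\<^bsub>Div G\<^esub> E" by (simp add: Div_def)
  then have "D \<in> principal_divisors G #>\<^bsub>Div G\<^esub> E"
    using assms(2) unfolding linearly_equivalent_def r_coset_def by blast
  then show ?thesis
    unfolding divisor_class_def
    using D.repr_independence[OF _ assms(1) principal_subgroup] by simp
qed

lemma divisor_class_mult:
  assumes "D \<in> carrier (Div G)" and "E \<in> carrier (Div G)"
  shows "divisor_class G D \<otimes>\<^bsub>Pic G\<^esub> divisor_class G E = divisor_class G (\<lambda>x. D x + E x)"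
proof -
  have "D \<otimes>\<^bsub>Div G\<^esub> E = (\<lambda>x. D x + E x)" by (simp add: Div_def)
  then show ?thesis
    using normal.rcos_sum[OF principal_normal assms]
    by (simp add: divisor_class_def Pic_def FactGroup_def)
qed

lemma edge_ordering_map_in_Div: "edge_ordering_map G arev es T \<in> carrier (Div G)"
proof -
  have "edge_ordering_map G arev es T x = 0" if "x \<notin> verts G" for x
    unfolding edge_ordering_map_def
    by (rule sum.neutral) (use that head_in_verts in \<open>auto simp: chip_def oriented_chords_def\<close>)
  then show ?thesis by (auto simp: Div_def)
qed

lemma boundary_in_Div0:
  assumes "e \<in> arcs G"
  shows "boundary G e \<in> carrier (Div0 G)"
proof -
  have "divisor_degree G (boundary G e) = 0"
    using assms by (simp add: divisor_degree_def boundary_def chip_def sum_subtractf)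
  moreover have "boundary G e x = 0" if "x \<notin> verts G" for x
    using that assms head_in_verts[OF assms] tail_in_verts[OF assms]
    by (auto simp: boundary_def chip_def)
  ultimately show ?thesis by (simp add: Div0_def Div_def)
qed

text \<open>\<open>Div0 G\<close> inherits its multiplication from \<open>Div G\<close>, so the
  coset formed in \<open>Div G\<close> is the same set as the one formed in
  \<open>Div0 G\<close>.\<close>

lemma divisor_class_in_Pic0:
  assumes "D \<in> carrier (Div0 G)"
  shows "divisor_class G D \<in> carrier (Pic0 G)"
  using assms
  by (auto simp: divisor_class_def Pic0_def FactGroup_def RCOSETS_def r_coset_def Div0_def)

end

theorem theorem5p8:
  fixes G :: "('a, 'b) pre_digraph" and arev :: "'b \<Rightarrow> 'b"
    and \<Phi> :: "'b set" and e1 :: 'b and es :: "'b list" and u v :: 'a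
  defines "\<beta> \<equiv> edge_ordering_map G arev (e1 # es)"
    and "\<beta>' \<equiv> edge_ordering_map G arev (arev e1 # es)"
  assumes "conn_multigraph G arev"
    and "forest_in G arev \<Phi>"
    and "ordering_data G arev \<Phi> (e1 # es)"
    and "tail G e1 = v" and "head G e1 = u"
  shows "isomorphic_torsors_with_translating_element G arev \<beta> \<beta>' (divisor_class G (boundary G e1))
    \<and> divisor_class G (boundary G e1) = divisor_class G (\<lambda>x. chip u x - chip v x)
    \<and> (\<forall>T. spanning_tree_in G arev T \<longrightarrow>
          linearly_equivalent G (\<lambda>x. \<beta> T x - \<beta>' T x) (\<lambda>x. chip u x - chip v x))"
proof -
  interpret conn_multigraph G arev by fact
  have e1: "e1 \<in> arcs G" using assms(5) by (simp add: ordering_data_def)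
  have bd: "boundary G e1 = (\<lambda>x. chip u x - chip v x)"
    using assms(6,7) by (simp add: boundary_def fun_eq_iff)
  have bdD: "boundary G e1 \<in> carrier (Div G)"
    using boundary_in_Div0[OF e1] by (simp add: Div0_def)
  have equiv: "linearly_equivalent G (\<lambda>x. \<beta> T x - \<beta>' T x) (boundary G e1)"
    if T: "spanning_tree_in G arev T" for T
  proof -
    obtain f where "\<And>x. \<beta> T x - \<beta>' T x - boundary G e1 x = laplacian G f x"
      using edge_ordering_map_flip_first[OF T e1] unfolding \<beta>_def \<beta>'_def by blast
    then show ?thesis by (simp add: linearly_equivalent_def principal_divisors_def)
  qed
  have "divisor_class G (\<beta> T) = divisor_class G (boundary G e1) \<otimes>\<^bsub>Pic G\<^esub> divisor_class G (\<beta>' T)"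
    if "spanning_tree_in G arev T" for T
  proof -
    have D: "\<beta>' T \<in> carrier (Div G)" unfolding \<beta>'_def by (rule edge_ordering_map_in_Div)
    have "(\<lambda>x. boundary G e1 x + \<beta>' T x) \<in> carrier (Div G)"
      using D bdD by (simp add: Div_def)
    \<comment> \<open>Moving \<open>\<beta>' T\<close> to the other side leaves the difference
      unchanged, and the class of the new right side splits as a product in
      \<open>Pic G\<close>.\<close>
    moreover have "linearly_equivalent G (\<beta> T) (\<lambda>x. boundary G e1 x + \<beta>' T x)"
      using equiv[OF that] by (simp add: linearly_equivalent_def algebra_simps)
    ultimately show ?thesis using divisor_class_mult[OF bdD D] divisor_class_eq by simp
  qed
  then have "isomorphic_torsors_with_translating_element G arev \<beta> \<beta>' (divisor_class G (boundary G e1))"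
    using divisor_class_in_Pic0[OF boundary_in_Div0[OF e1]]
    by (simp add: isomorphic_torsors_with_translating_element_def)
  then show ?thesis using equiv bd by simp
qed

end
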